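(* There is an absolute constant $C$ such that the following holds. Let $t\ge 2$ and $k\ge1$. Then for every $n$ and every $t$-separable input sequence $X\in[0,1]^n$, we have $\mathrm{OPT}_k(X)\le C\cdot k\cdot t\cdot n^{1/(\lfloor \log_2 k\rfloor+1)}$.
   Context: Inflation: for a permutation $\pi$ of length $m$ and permutations $\rho_1,\dots,\rho_m$, the inflation of $\pi$ by $\rho_1,\dots,\rho_m$ is the unique permutation obtained by replacing each entry $\pi_i$ by a shift (adding a constant to every entry) of $\rho_i$, with the shifts chosen so that the blocks are ordered relative to each other as the entries of $\pi$ (equivalently, in the point-set picture, each point of $\pi$ is replaced by a small copy of $\rho_i$). A permutation is $t$-separable if it is the 1-element permutation, or the inflation of a permutation of length at most $t$ by $t$-separable permutations. A real sequence is $t$-separable if its entries are pairwise distinct and it is order-isomorphic to a $t$-separable permutation (two sequences $(x_i),(y_i)$ are order-isomorphic if $x_i<x_j\iff y_i<y_j$ for all $i,j$). $k$-server on the line: given requests $X=(x_1,\dots,x_n)\in[0,1]^n$ and $k$ servers, let $p_i^j\in[0,1]$ be the position of server $j$ after serving request $i$, with $p_0^j=0$ for all $j$. The positions are a valid solution if for each $i\in[n]$ some $j$ has $p_i^j=x_i$. The cost is $\sum_{i\in[n]}\sum_{j\in[k]}|p_i^j-p_{i-1}^j|$, and $\mathrm{OPT}_k(X)$ is the minimum cost of a valid solution. *)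

theory Defs
  imports "HOL-Analysis.Analysis"
begin

text \<open>Permutations are lists in one-line notation, with values \<open>1, \<dots>, m\<close>.\<close>

definition is_perm :: "nat list \<Rightarrow> bool" where
  "is_perm p \<longleftrightarrow> distinct p \<and> set p = {1..length p}"

text \<open>The shift of the \<open>i\<close>-th block is the total length of all blocks that have to lie below it;
  this is the only choice for which the blocks are ordered like the entries of \<open>p\<close> and the result
  is again a permutation.\<close>

definition inflation_shift :: "nat list \<Rightarrow> nat list list \<Rightarrow> nat \<Rightarrow> nat" where
  "inflation_shift p rs i = (\<Sum>j | j < length p \<and> p ! j < p ! i. length (rs ! j))"

definition inflation :: "nat list \<Rightarrow> nat list list \<Rightarrow> nat list" where
  "inflation p rs =
     concat (map (\<lambda>i. map (\<lambda>x. x + inflation_shift p rs i) (rs ! i)) [0..<length p])"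

lemma inflation_shift_step:
  assumes "i < length p" "p ! i < p ! j"
  shows "inflation_shift p rs i + length (rs ! i) \<le> inflation_shift p rs j"
proof -
  have "inflation_shift p rs i + length (rs ! i)
        = (\<Sum>l \<in> insert i {l. l < length p \<and> p ! l < p ! i}. length (rs ! l))"
    unfolding inflation_shift_def by (subst sum.insert) auto
  also have "\<dots> \<le> inflation_shift p rs j"
    unfolding inflation_shift_def using assms by (intro sum_mono2) auto
  finally show ?thesis .
qed

lemma inflation_blocks_ordered:
  assumes "\<forall>r \<in> set rs. is_perm r" "length rs = length p"
    and "i < length p" "j < length p" "p ! i < p ! j"
    and "x \<in> set (rs ! i)" "y \<in> set (rs ! j)"
  shows "x + inflation_shift p rs i < y + inflation_shift p rs j"
proof -
  have "x \<le> length (rs ! i)" "1 \<le> y"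
    using assms unfolding is_perm_def by (metis atLeastAtMost_iff nth_mem)+
  with inflation_shift_step[OF assms(3,5), of rs] show ?thesis by linarith
qed

lemma length_inflation:
  "length (inflation p rs) = (\<Sum>i<length p. length (rs ! i))"
  by (simp add: inflation_def length_concat comp_def sum_list_sum_nth atLeast0LessThan)

lemma is_perm_inflation:
  assumes p: "is_perm p" and rs: "\<forall>r \<in> set rs. is_perm r" and len: "length rs = length p"
  shows "is_perm (inflation p rs)"
proof -
  define B where "B i = map (\<lambda>x. x + inflation_shift p rs i) (rs ! i)" for i
  have infl: "inflation p rs = concat (map B [0..<length p])"
    by (simp add: inflation_def B_def[abs_def])
  have permi: "is_perm (rs ! i)" if "i < length p" for i
    using rs len that by simp
  have disj: "set (B i) \<inter> set (B j) = {}"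
    if "i < length p" "j < length p" "i \<noteq> j" for i j
  proof -
    have "p ! i \<noteq> p ! j"
      using p that by (simp add: is_perm_def nth_eq_iff_index_eq)
    then consider "p ! i < p ! j" | "p ! j < p ! i" by linarith
    then show ?thesis
    proof cases
      case 1
      then show ?thesis
        using inflation_blocks_ordered[OF rs len that(1,2)] by (fastforce simp: B_def)
    next
      case 2
      then show ?thesis
        using inflation_blocks_ordered[OF rs len that(2,1)] by (fastforce simp: B_def)
    qed
  qed
  have dB: "distinct (B i)" if "i < length p" for i
    using permi[OF that] by (auto simp: B_def is_perm_def distinct_map inj_on_def)
  have dist: "distinct (concat (map B [0..<n]))" if "n \<le> length p" for n
    using that
  proof (induction n)
    case (Suc n)
    have "set (B n) \<inter> set (B i) = {}" if "i < n" for i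
      using disj[of n i] that Suc.prems by simp
    then have "set (B n) \<inter> set (concat (map B [0..<n])) = {}" by fastforce
    with Suc dB[of n] show ?case by auto
  qed simp
  have "set (inflation p rs) \<subseteq> {1..length (inflation p rs)}"
  proof
    fix z assume "z \<in> set (inflation p rs)"
    then obtain i x where i: "i < length p" and x: "x \<in> set (rs ! i)"
      and z: "z = x + inflation_shift p rs i"
      by (auto simp: infl B_def)
    have x': "1 \<le> x" "x \<le> length (rs ! i)"
      using permi[OF i] x by (auto simp: is_perm_def)
    have "length (rs ! i) + inflation_shift p rs i
          = (\<Sum>l \<in> insert i {l. l < length p \<and> p ! l < p ! i}. length (rs ! l))"
      unfolding inflation_shift_def by (subst sum.insert) auto
    also have "\<dots> \<le> length (inflation p rs)"
      unfolding length_inflation using i by (intro sum_mono2) auto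
    finally show "z \<in> {1..length (inflation p rs)}" using x' z by simp
  qed
  moreover have "distinct (inflation p rs)" using dist[of "length p"] infl by simp
  ultimately show ?thesis
    unfolding is_perm_def by (simp add: card_subset_eq distinct_card)
qed

inductive separable_perm :: "nat \<Rightarrow> nat list \<Rightarrow> bool" for t :: nat where
  single: "separable_perm t [1]"
| inflate: "\<lbrakk>is_perm p; p \<noteq> []; length p \<le> t; length rs = length p;
     \<forall>r \<in> set rs. separable_perm t r\<rbrakk> \<Longrightarrow> separable_perm t (inflation p rs)"

lemma is_perm_separable_perm: "separable_perm t s \<Longrightarrow> is_perm s"
proof (induction rule: separable_perm.induct)
  case single
  show ?case by (simp add: is_perm_def)
next
  case (inflate p rs)
  then show ?case by (intro is_perm_inflation) auto
qed

definition order_isomorphic :: "'a::linorder list \<Rightarrow> 'b::linorder list \<Rightarrow> bool" where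
  "order_isomorphic xs ys \<longleftrightarrow> length xs = length ys \<and>
     (\<forall>i < length xs. \<forall>j < length xs. xs ! i < xs ! j \<longleftrightarrow> ys ! i < ys ! j)"

definition separable_seq :: "nat \<Rightarrow> real list \<Rightarrow> bool" where
  "separable_seq t xs \<longleftrightarrow> distinct xs \<and> (\<exists>s. separable_perm t s \<and> order_isomorphic xs s)"

text \<open>\<open>p i j\<close> is the position of server \<open>j \<in> {1..k}\<close> after serving request \<open>i \<in> {1..n}\<close>; request
  \<open>i\<close> is the list entry \<open>X ! (i - 1)\<close>. Values of \<open>p\<close> outside these ranges are irrelevant.\<close>

definition kserver_solution :: "nat \<Rightarrow> real list \<Rightarrow> (nat \<Rightarrow> nat \<Rightarrow> real) \<Rightarrow> bool" where
  "kserver_solution k X p \<longleftrightarrow>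
     (\<forall>i \<le> length X. \<forall>j \<in> {1..k}. p i j \<in> {0..1}) \<and>
     (\<forall>j \<in> {1..k}. p 0 j = 0) \<and>
     (\<forall>i \<in> {1..length X}. \<exists>j \<in> {1..k}. p i j = X ! (i - 1))"

definition kserver_cost :: "nat \<Rightarrow> nat \<Rightarrow> (nat \<Rightarrow> nat \<Rightarrow> real) \<Rightarrow> real" where
  "kserver_cost k n p = (\<Sum>i = 1..n. \<Sum>j = 1..k. \<bar>p i j - p (i - 1) j\<bar>)"

definition OPT :: "nat \<Rightarrow> real list \<Rightarrow> real" where
  "OPT k X = Inf (kserver_cost k (length X) ` {p. kserver_solution k X p})"

text \<open>The infimum is a minimum.\<close>

lemma OPT_attained:
  assumes k: "k \<ge> 1" and X: "set X \<subseteq> {0..1}"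
  obtains p where "kserver_solution k X p" "OPT k X = kserver_cost k (length X) p"
    "\<And>q. kserver_solution k X q \<Longrightarrow> kserver_cost k (length X) p \<le> kserver_cost k (length X) q"
proof -
  let ?n = "length X"
  let ?cost = "\<lambda>f :: nat \<times> nat \<Rightarrow> real. kserver_cost k ?n (\<lambda>i j. f (i, j))"
  define K :: "(nat \<times> nat \<Rightarrow> real) set" where "K = Pi\<^sub>E UNIV (\<lambda>_. {0..1})"
  define V where "V = (\<Inter>j \<in> {1..k}. {f :: nat \<times> nat \<Rightarrow> real. f (0, j) = 0}) \<inter>
    (\<Inter>i \<in> {1..?n}. \<Union>j \<in> {1..k}. {f. f (i, j) = X ! (i - 1)})"
  have cl: "closed {f :: nat \<times> nat \<Rightarrow> real. f a = c}" for a c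
    by (intro closed_Collect_eq continuous_on_product_coordinates continuous_on_const)
  have "compact K"
  proof -
    have "compactin (product_topology (\<lambda>_. euclidean) UNIV) K"
      unfolding K_def by (simp add: compactin_PiE)
    then show ?thesis by (simp add: euclidean_product_topology)
  qed
  moreover have "closed V"
    unfolding V_def by (intro closed_Int closed_INT closed_UN ballI cl) auto
  ultimately have cpt: "compact (K \<inter> V)" by blast
  have cont: "continuous_on (K \<inter> V) ?cost"
    unfolding kserver_cost_def
    by (intro continuous_intros continuous_on_subset[OF continuous_on_product_coordinates]) auto
  have sol: "kserver_solution k X (\<lambda>i j. f (i, j))" if "f \<in> K \<inter> V" for f
    using that unfolding K_def V_def kserver_solution_def by (auto simp: PiE_iff)
  define trunc where "trunc q = (\<lambda>(i, j). if i \<le> ?n \<and> j \<in> {1..k} then q i j else (0::real))" for q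
  have trunc: "trunc q \<in> K \<inter> V" "?cost (trunc q) = kserver_cost k ?n q"
    if "kserver_solution k X q" for q
  proof -
    have "trunc q \<in> K"
      using that by (auto simp: K_def PiE_iff trunc_def kserver_solution_def)
    moreover have "trunc q \<in> V"
      using that by (simp add: V_def trunc_def kserver_solution_def)
    ultimately show "trunc q \<in> K \<inter> V" by blast
    show "?cost (trunc q) = kserver_cost k ?n q"
      unfolding kserver_cost_def trunc_def by (intro sum.cong) auto
  qed
  have "X ! (i - 1) \<in> {0..1}" if "i \<le> ?n" "i \<noteq> 0" for i
    using X nth_mem[of "i - 1" X] that by (metis One_nat_def Suc_le_eq Suc_pred bot_nat_0.not_eq_extremum subsetD)
  then have "kserver_solution k X (\<lambda>i j. if i = 0 then 0 else X ! (i - 1))"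
    using k unfolding kserver_solution_def by (simp add: Bex_def) (metis le_refl)
  then have "K \<inter> V \<noteq> {}" using trunc by blast
  then obtain f where f: "f \<in> K \<inter> V" and min: "\<And>g. g \<in> K \<inter> V \<Longrightarrow> ?cost f \<le> ?cost g"
    using continuous_attains_inf[OF cpt _ cont] by blast
  have le: "?cost f \<le> kserver_cost k ?n q" if "kserver_solution k X q" for q
    using min[OF trunc(1)[OF that]] trunc(2)[OF that] by simp
  have "OPT k X = ?cost f"
    unfolding OPT_def using sol[OF f] le by (intro cInf_eq_minimum) auto
  with sol[OF f] le show ?thesis using that by blast
qed

end

theory Submission
  imports Defs
begin

text \<open>
  Every block of the recursive decomposition occupies its own interval of values, and sibling
  blocks occupy disjoint intervals. Induct on \<open>d = \<lfloor>log\<^sub>2 k\<rfloor>\<close>: split \<open>2 * g\<close> servers, \<open>g = 2 ^ d\<close>,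
  into a lower and an upper group, and call a block large if its length is at least
  \<open>m = n powr ((d + 1) / (d + 2))\<close>. A small block is served by one group alone, and these costs add
  up to at most the induction bound for \<open>m\<close>, because the value intervals are disjoint. To serve a
  large block, the lower group waits at the lower end of its interval and the upper group at the
  upper end. If exactly one child is large, the lower group serves the small children below the
  large one and the upper group those above it, so that the travelling costs at most \<open>2 * g * t\<close>
  times the width lost from the block to its large child; along a chain of such blocks this
  telescopes. The remaining large blocks have no large child or at least two, so there are at most
  \<open>2 * n / m\<close> of them, and the travelling for each costs at most \<open>2 * g * t\<close> times its width.
\<close>

section \<open>Blocks of values\<close>

text \<open>Of the order among sibling blocks only one thing is remembered: their value intervals
  share at most an endpoint. The bounds \<open>a\<close> and \<open>b\<close> need not be attained,
  so the whole input can be placed in \<open>{0..1}\<close>.\<close>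

inductive separable_within :: "nat \<Rightarrow> real \<Rightarrow> real \<Rightarrow> real list \<Rightarrow> bool" for t :: nat where
  single: "a \<le> x \<Longrightarrow> x \<le> b \<Longrightarrow> separable_within t a b [x]"
| blocks: "\<lbrakk>0 < n; n \<le> t; \<And>i. i < n \<Longrightarrow> separable_within t (lo i) (hi i) (xs i);
     \<And>i. i < n \<Longrightarrow> a \<le> lo i; \<And>i. i < n \<Longrightarrow> hi i \<le> b;
     \<And>i j. i < n \<Longrightarrow> j < n \<Longrightarrow> i \<noteq> j \<Longrightarrow> hi i \<le> lo j \<or> hi j \<le> lo i\<rbrakk>
   \<Longrightarrow> separable_within t a b (concat (map xs [0..<n]))"

lemma separable_within_subset: "separable_within t a b xs \<Longrightarrow> set xs \<subseteq> {a..b}"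
proof (induction rule: separable_within.induct)
  case (blocks n lo hi xs a b)
  show ?case
  proof
    fix x assume "x \<in> set (concat (map xs [0..<n]))"
    then obtain i where "i < n" "x \<in> set (xs i)" by auto
    then show "x \<in> {a..b}" using blocks.IH[of i] blocks.hyps(4,5)[of i] by force
  qed
qed auto

lemma separable_within_nonempty: "separable_within t a b xs \<Longrightarrow> xs \<noteq> []"
  by (induction rule: separable_within.induct) auto

lemma separable_within_le:
  assumes "separable_within t a b xs"
  shows "a \<le> b"
  using separable_within_subset[OF assms] separable_within_nonempty[OF assms]
  by (cases xs) auto

text \<open>The map \<open>\<phi>\<close> is generalised in the induction because a block of an
  inflation is a shifted copy of the child permutation: the child is treated with
  \<open>\<phi>\<close> composed with the shift. Its interval is spanned by the least and the
  greatest of its values.\<close>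

lemma separable_within_map:
  assumes "separable_perm t s" "strict_mono_on (set s) \<phi>" "\<phi> ` set s \<subseteq> {a..b}"
  shows "separable_within t a b (map \<phi> s)"
  using assms
proof (induction arbitrary: \<phi> a b rule: separable_perm.induct)
  case single
  then show ?case by (auto intro: separable_within.single)
next
  case (inflate p rs)
  define sh where "sh i x = x + inflation_shift p rs i" for i x
  define xs where "xs i = map (\<phi> \<circ> sh i) (rs ! i)" for i
  have eq: "map \<phi> (inflation p rs) = concat (map xs [0..<length p])"
    by (simp add: inflation_def map_concat xs_def[abs_def] comp_def sh_def)
  have rs: "\<forall>r\<in>set rs. is_perm r"
    using inflate.IH is_perm_separable_perm by blast
  have sub: "sh i ` set (rs ! i) \<subseteq> set (inflation p rs)" if "i < length p" for i
    using that by (auto simp: inflation_def sh_def)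
  have sep: "separable_within t (Min (set (xs i))) (Max (set (xs i))) (xs i)"
    if i: "i < length p" for i
  proof -
    have "rs ! i \<in> set rs" using i inflate.hyps by simp
    moreover have "strict_mono_on (set (rs ! i)) (\<phi> \<circ> sh i)"
      using sub[OF i] inflate.prems(1) unfolding strict_mono_on_def
      by (auto simp: sh_def image_subset_iff)
    moreover have "(\<phi> \<circ> sh i) ` set (rs ! i) \<subseteq> {Min (set (xs i))..Max (set (xs i))}"
      by (auto simp: xs_def)
    ultimately show ?thesis
      using inflate.IH unfolding xs_def[of i] by blast
  qed
  have ne: "set (xs i) \<noteq> {}" if "i < length p" for i
    using separable_within_nonempty[OF sep[OF that]] by simp
  have bd: "set (xs i) \<subseteq> {a..b}" if "i < length p" for i
    using sub[OF that] inflate.prems(2) by (auto simp: xs_def)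
  have below: "Max (set (xs i)) \<le> Min (set (xs j))"
    if ij: "i < length p" "j < length p" "p ! i < p ! j" for i j
  proof -
    have "u \<le> v" if "u \<in> set (xs i)" "v \<in> set (xs j)" for u v
    proof -
      obtain x y where x: "x \<in> set (rs ! i)" "u = \<phi> (sh i x)"
        and y: "y \<in> set (rs ! j)" "v = \<phi> (sh j y)"
        using \<open>u \<in> _\<close> \<open>v \<in> _\<close> by (auto simp: xs_def)
      have "sh i x < sh j y"
        unfolding sh_def
        using inflation_blocks_ordered[OF rs _ ij x(1) y(1)] inflate.hyps by simp
      then have "u < v"
        using x y sub ij inflate.prems(1) by (auto simp: image_subset_iff intro: strict_mono_onD)
      then show ?thesis by simp
    qed
    then show ?thesis using ne ij by simp
  qed
  show ?case unfolding eq
  proof (rule separable_within.blocks[OF _ _ sep])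
    fix i j assume ij: "i < length p" "j < length p" "i \<noteq> j"
    then have "p ! i \<noteq> p ! j"
      using inflate.hyps(1) by (simp add: is_perm_def nth_eq_iff_index_eq)
    then show "Max (set (xs i)) \<le> Min (set (xs j)) \<or> Max (set (xs j)) \<le> Min (set (xs i))"
      using below ij by (meson linorder_neqE_nat)
  next
    fix i assume i: "i < length p"
    then have "Min (set (xs i)) \<in> {a..b}" "Max (set (xs i)) \<in> {a..b}"
      using bd[OF i] Min_in[OF _ ne[OF i]] Max_in[OF _ ne[OF i]] by (blast intro: List.finite_set)+
    then show "a \<le> Min (set (xs i))" "Max (set (xs i)) \<le> b" by auto
  qed (use inflate.hyps in auto)
qed

text \<open>Replacing each value of \<open>s\<close> by the entry of \<open>X\<close> at the same
  position is strictly monotone, by order isomorphism, and turns \<open>s\<close> into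
  \<open>X\<close>.\<close>

lemma separable_seq_within:
  assumes "separable_seq t X" "set X \<subseteq> {a..b}"
  shows "separable_within t a b X"
proof -
  obtain s where s: "separable_perm t s" and iso: "order_isomorphic X s"
    using assms unfolding separable_seq_def by blast
  have d: "distinct s" using is_perm_separable_perm[OF s] by (simp add: is_perm_def)
  define idx where "idx = inv_into {..<length s} ((!) s)"
  have inj: "inj_on ((!) s) {..<length s}" using d by (simp add: inj_on_nth)
  have idx: "idx (s ! i) = i" if "i < length s" for i
    unfolding idx_def using inv_into_f_f[OF inj] that by simp
  have len: "length X = length s" using iso by (simp add: order_isomorphic_def)
  have X: "X = map (\<lambda>v. X ! idx v) s"
    by (rule nth_equalityI) (auto simp: len idx)
  have "strict_mono_on (set s) (\<lambda>v. X ! idx v)"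
  proof (rule strict_mono_onI)
    fix u v assume "u \<in> set s" "v \<in> set s" "u < v"
    then obtain i j where "i < length s" "j < length s" "u = s ! i" "v = s ! j"
      by (metis in_set_conv_nth)
    then show "X ! idx u < X ! idx v"
      using iso \<open>u < v\<close> by (auto simp: order_isomorphic_def idx)
  qed
  moreover have "(\<lambda>v. X ! idx v) ` set s \<subseteq> {a..b}"
    using assms(2) X by (metis set_map)
  ultimately have "separable_within t a b (map (\<lambda>v. X ! idx v) s)"
    using separable_within_map[OF s] by blast
  then show ?thesis using X by simp
qed

text \<open>Half-open intervals are disjoint even when neighbours share an endpoint, so their
  lengths add up as Lebesgue measures inside \<open>{a..b}\<close>. This is why costs proportional
  to width do not accumulate over siblings.\<close>

lemma sum_lengths_disjoint_intervals_le:
  fixes lo hi :: "'i \<Rightarrow> real"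
  assumes "finite I" "a \<le> b" "\<And>i. i \<in> I \<Longrightarrow> a \<le> lo i" "\<And>i. i \<in> I \<Longrightarrow> lo i \<le> hi i"
    "\<And>i. i \<in> I \<Longrightarrow> hi i \<le> b"
    "\<And>i j. i \<in> I \<Longrightarrow> j \<in> I \<Longrightarrow> i \<noteq> j \<Longrightarrow> hi i \<le> lo j \<or> hi j \<le> lo i"
  shows "(\<Sum>i\<in>I. hi i - lo i) \<le> b - a"
proof -
  have "(\<Sum>i\<in>I. hi i - lo i) = (\<Sum>i\<in>I. measure lborel {lo i..<hi i})"
    using assms by (intro sum.cong) auto
  also have "\<dots> = measure lborel (\<Union>i\<in>I. {lo i..<hi i})"
  proof (rule measure_finite_Union[symmetric])
    show "disjoint_family_on (\<lambda>i. {lo i..<hi i}) I"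
      using assms(6) unfolding disjoint_family_on_def by fastforce
  qed (use assms in auto)
  also have "\<dots> \<le> measure lborel {a..b}"
    using assms by (intro measure_mono_fmeasurable) (force simp: fmeasurable_def)+
  finally show ?thesis using assms by simp
qed

section \<open>Serving a sequence of requests\<close>

definition moving_cost :: "'s set \<Rightarrow> ('s \<Rightarrow> real) \<Rightarrow> ('s \<Rightarrow> real) \<Rightarrow> real" where
  "moving_cost J p q = (\<Sum>j\<in>J. \<bar>p j - q j\<bar>)"

lemma moving_cost_commute: "moving_cost J p q = moving_cost J q p"
  by (simp add: moving_cost_def abs_minus_commute)

lemma moving_cost_self [simp]: "moving_cost J p p = 0"
  by (simp add: moving_cost_def)

lemma moving_cost_triangle: "moving_cost J p r \<le> moving_cost J p q + moving_cost J q r"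
  unfolding moving_cost_def sum.distrib[symmetric] by (intro sum_mono) linarith

lemma moving_cost_le:
  fixes a b :: real
  assumes "\<And>j. j \<in> J \<Longrightarrow> p j \<in> {a..b}" "\<And>j. j \<in> J \<Longrightarrow> q j \<in> {a..b}"
  shows "moving_cost J p q \<le> real (card J) * (b - a)"
  unfolding moving_cost_def using assms
  by (intro order_trans[OF sum_bounded_above[of J _ "b - a"]]) (fastforce simp: abs_le_iff)+

text \<open>The number \<open>c\<close> is only an upper bound for the cost, and it includes a last
  move to \<open>q\<close> after all requests, so that schedules can be chained. Positions are not
  confined to \<open>{0..1}\<close>.\<close>

inductive serves :: "'s set \<Rightarrow> ('s \<Rightarrow> real) \<Rightarrow> real list \<Rightarrow> ('s \<Rightarrow> real) \<Rightarrow> real \<Rightarrow> bool"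
  for J :: "'s set" where
  move: "moving_cost J p q \<le> c \<Longrightarrow> serves J p [] q c"
| request: "\<lbrakk>moving_cost J p r \<le> c; j \<in> J; r j = x; serves J r xs q c'\<rbrakk>
   \<Longrightarrow> serves J p (x # xs) q (c + c')"

lemma serves_mono: "serves J p xs q c \<Longrightarrow> c \<le> c' \<Longrightarrow> serves J p xs q c'"
proof (induction arbitrary: c' rule: serves.induct)
  case (move p q c)
  then show ?case by (auto intro: serves.move)
next
  case (request p r c j x xs q c1)
  \<comment> \<open>The slack is handed down to the last move, which absorbs it.\<close>
  then have "serves J r xs q (c' - c)" by simp
  from serves.request[OF request.hyps(1-3) this] show ?case by simp
qed

lemma serves_move_first:
  assumes "serves J q xs r c" "moving_cost J p q \<le> e"
  shows "serves J p xs r (e + c)"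
  using assms
proof (cases rule: serves.cases)
  case move
  then show ?thesis
    using assms(2) moving_cost_triangle[of J p r q] by (auto intro!: serves.move)
next
  case (request r' c1 j x xs' c2)
  have "moving_cost J p r' \<le> e + c1"
    using assms(2) request moving_cost_triangle[of J p r' q] by linarith
  from serves.request[OF this request(4,5,6)] show ?thesis
    using request by (simp add: add.assoc)
qed

lemma serves_append:
  assumes "serves J p xs q c" "serves J q ys r c'"
  shows "serves J p (xs @ ys) r (c + c')"
  using assms
proof (induction rule: serves.induct)
  case (move p q c)
  then show ?case by (simp add: serves_move_first)
next
  case (request p r' c j x xs q c1)
  then show ?case
    using serves.request[OF request.hyps(1-3)] by (simp add: add.assoc)
qed

lemma serves_excursion:
  assumes "serves J q xs q c" "moving_cost J p q \<le> e"
  shows "serves J p xs p (c + 2 * e)"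
proof -
  have "serves J q [] p e" using assms(2) by (simp add: serves.move moving_cost_commute)
  from serves_append[OF serves_move_first[OF assms] this] show ?thesis
    by (simp add: algebra_simps)
qed

lemma serves_concat:
  assumes "\<And>i. i < n \<Longrightarrow> serves J p (xs i) p (c i)"
  shows "serves J p (concat (map xs [0..<n])) p (\<Sum>i<n. c i)"
  using assms
proof (induction n)
  case (Suc n)
  then have "serves J p (concat (map xs [0..<n]) @ xs n) p ((\<Sum>i<n. c i) + c n)"
    by (intro serves_append) auto
  then show ?case by simp
qed (simp add: serves.move)

text \<open>The additional servers stay where \<open>p\<close> puts them (\<open>ext\<close>) and
  cost nothing.\<close>

lemma serves_superset:
  assumes "serves J p xs p c" "J \<subseteq> K" "finite K"
  shows "serves K p xs p c"
proof -
  define ext where "ext q j = (if j \<in> J then q j else p j)" for q j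
  have cost: "moving_cost K (ext q) (ext r) = moving_cost J q r" for q r
  proof -
    have "moving_cost K (ext q) (ext r) = (\<Sum>j\<in>K. if j \<in> J then \<bar>q j - r j\<bar> else 0)"
      unfolding moving_cost_def ext_def by (intro sum.cong) auto
    also have "\<dots> = (\<Sum>j\<in>K \<inter> J. \<bar>q j - r j\<bar>)"
      using assms(3) by (simp add: sum.If_cases)
    also have "K \<inter> J = J" using assms(2) by blast
    finally show ?thesis by (simp add: moving_cost_def)
  qed
  have "serves K (ext q) xs (ext r) c" if "serves J q xs r c" for q r
    using that
  proof (induction rule: serves.induct)
    case (move p' q c)
    then show ?case by (simp add: serves.move cost)
  next
    case (request p' r c j x xs q c')
    then show ?case
      using assms(2) by (intro serves.request[of K _ "ext r" c j]) (auto simp: cost, auto simp: ext_def)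
  qed
  moreover have "ext p = p" by (auto simp: ext_def)
  ultimately show ?thesis using assms(1) by metis
qed

text \<open>There is one move per request and one to the final position, each within
  \<open>{a..b}\<close>.\<close>

lemma serves_single_server:
  fixes a b :: real
  assumes "set xs \<subseteq> {a..b}" "p j \<in> {a..b}" "q j \<in> {a..b}"
  shows "serves {j} p xs q (real (length xs + 1) * (b - a))"
  using assms
proof (induction xs arbitrary: p)
  case Nil
  then show ?case by (auto intro!: serves.move simp: moving_cost_def)
next
  case (Cons x xs)
  \<comment> \<open>Only the value at \<open>j\<close> matters, so a constant configuration will
    do.\<close>
  have "serves {j} (\<lambda>_. x) xs q (real (length xs + 1) * (b - a))"
    using Cons by simp
  moreover have "moving_cost {j} p (\<lambda>_. x) \<le> b - a"
    using Cons.prems by (auto simp: moving_cost_def)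
  ultimately have "serves {j} p (x # xs) q (b - a + real (length xs + 1) * (b - a))"
    by (intro serves.request) auto
  then show ?case by (simp add: algebra_simps)
qed

section \<open>From \<open>serves\<close> to solutions of the k-server problem\<close>

lemma serves_schedule:
  assumes "serves J p xs q c"
  obtains P where "P 0 = p" "\<And>i. i < length xs \<Longrightarrow> \<exists>j\<in>J. P (Suc i) j = xs ! i"
    "(\<Sum>i<length xs. moving_cost J (P i) (P (Suc i))) \<le> c"
proof -
  have "\<exists>P. P 0 = p \<and> (\<forall>i < length xs. \<exists>j\<in>J. P (Suc i) j = xs ! i) \<and>
    (\<Sum>i<length xs. moving_cost J (P i) (P (Suc i))) \<le> c"
    using assms
  proof (induction rule: serves.induct)
    case (move p q c)
    have "0 \<le> moving_cost J p q" by (simp add: moving_cost_def sum_nonneg)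
    \<comment> \<open>The last move to \<open>q\<close> is dropped; its cost only makes
      \<open>c\<close> larger.\<close>
    then show ?case using move by (intro exI[of _ "\<lambda>_. p"]) simp
  next
    case (request p r c j x xs q c')
    then obtain P where P: "P 0 = r" "\<forall>i < length xs. \<exists>j\<in>J. P (Suc i) j = xs ! i"
      "(\<Sum>i<length xs. moving_cost J (P i) (P (Suc i))) \<le> c'" by blast
    have "\<exists>j\<in>J. P i j = (x # xs) ! i" if "i < Suc (length xs)" for i
      using that P request.hyps by (cases i) auto
    then show ?case using P request.hyps
      by (intro exI[of _ "case_nat p P"])
        (simp add: sum.lessThan_Suc_shift del: sum.lessThan_Suc)
  qed
  then show ?thesis using that by blast
qed

text \<open>Clamping all positions to \<open>{0..1}\<close> never lengthens a move and leaves the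
  requested points fixed.\<close>

lemma OPT_le_serves:
  assumes k: "k \<ge> 1" and X: "set X \<subseteq> {0..1}" and s: "serves {1..k} (\<lambda>_. 0) X q c"
  shows "OPT k X \<le> c"
proof -
  obtain P where P: "P 0 = (\<lambda>_. 0)" "\<And>i. i < length X \<Longrightarrow> \<exists>j\<in>{1..k}. P (Suc i) j = X ! i"
    "(\<Sum>i<length X. moving_cost {1..k} (P i) (P (Suc i))) \<le> c"
    using serves_schedule[OF s] by blast
  define Q where "Q i j = max 0 (min 1 (P i j))" for i j
  have "kserver_solution k X Q"
    unfolding kserver_solution_def
  proof (intro conjI ballI allI impI)
    fix i assume i: "i \<in> {1..length X}"
    then obtain j where j: "j \<in> {1..k}" "P i j = X ! (i - 1)"
      using P(2)[of "i - 1"] by force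
    moreover have "X ! (i - 1) \<in> {0..1}"
      using i by (intro subsetD[OF X] nth_mem) auto
    ultimately show "\<exists>j\<in>{1..k}. Q i j = X ! (i - 1)"
      by (intro bexI[of _ j]) (auto simp: Q_def)
  qed (auto simp: Q_def P)
  then have "OPT k X \<le> kserver_cost k (length X) Q"
    using OPT_attained[OF k X] by metis
  also have "\<dots> = (\<Sum>i<length X. moving_cost {1..k} (Q i) (Q (Suc i)))"
    unfolding kserver_cost_def moving_cost_def
    by (rule sum.reindex_bij_witness[of _ Suc "\<lambda>i. i - 1"]) (auto simp: abs_minus_commute)
  also have "\<dots> \<le> (\<Sum>i<length X. moving_cost {1..k} (P i) (P (Suc i)))"
    unfolding moving_cost_def Q_def by (intro sum_mono) linarith
  finally show ?thesis using P(3) by linarith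
qed

section \<open>Two groups of servers\<close>

definition spread :: "'s set \<Rightarrow> real \<Rightarrow> real \<Rightarrow> 's \<Rightarrow> real" where
  "spread L a b = (\<lambda>j. if j \<in> L then a else b)"

lemma moving_cost_spread:
  fixes a b a' b' :: real
  assumes "finite L" "finite U" "L \<inter> U = {}"
  shows "moving_cost (L \<union> U) (spread L a b) (spread L a' b')
    = real (card L) * \<bar>a - a'\<bar> + real (card U) * \<bar>b - b'\<bar>"
proof -
  have "moving_cost (L \<union> U) (spread L a b) (spread L a' b')
      = (\<Sum>j\<in>L. \<bar>a - a'\<bar>) + (\<Sum>j\<in>U. \<bar>b - b'\<bar>)"
    unfolding moving_cost_def sum.union_disjoint[OF assms]
    using assms by (intro arg_cong2[of _ _ _ _ "(+)"] sum.cong) (auto simp: spread_def)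
  then show ?thesis by simp
qed

text \<open>The assumption \<open>small\<close> is what the induction on the number of servers
  supplies. In \<open>extra\<close>, the term with \<open>b - a\<close> telescopes along chains of
  blocks with one large child. The factor \<open>2 * n / m - 1\<close> bounds the number of other
  large blocks, as in a tree whose leaves have size at least \<open>m\<close>; its
  \<open>- 1\<close> lets two or more large children leave one unit for their parent.
  \<open>W\<close> bounds the widths of all blocks in the recursion.\<close>

lemma serves_two_groups:
  fixes L U :: "'s set" and F W m :: real and g t :: nat
  assumes fin: "finite L" "finite U" "L \<inter> U = {}" and g: "card L = g" "card U = g" "1 \<le> g"
    and t: "1 \<le> t" and m: "0 < m" and F: "0 \<le> F"
    and small: "\<And>J a b xs p. J \<in> {L, U} \<Longrightarrow> separable_within t a b xs \<Longrightarrow> length xs < m \<Longrightarrow>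
      (\<And>j. j \<in> J \<Longrightarrow> p j \<in> {a..b}) \<Longrightarrow> serves J p xs p (F * (b - a))"
  defines "extra \<equiv> \<lambda>(a :: real) (b :: real) (n :: nat). if real n < m then 0
    else 2 * real g * real t * (b - a) + 2 * real g * real t * W * (2 * real n / m - 1)"
  assumes "separable_within t a b xs" "b - a \<le> W"
  shows "serves (L \<union> U) (spread L a b) xs (spread L a b) (F * (b - a) + extra a b (length xs))"
  using assms(12,13)
proof (induction rule: separable_within.induct)
  case (single a x b)
  have "L \<noteq> {}" using g by auto
  then obtain j where j: "j \<in> L" by blast
  show ?case
  proof (cases "1 < m")
    case True
    have "serves L (spread L a b) [x] (spread L a b) (F * (b - a))"
      using single True
      by (intro small separable_within.single) (auto simp: spread_def)
    then show ?thesis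
      using True fin by (auto simp: extra_def intro: serves_superset)
  next
    case False
    \<comment> \<open>Here \<open>m\<close> is at most 1, so even one request is large. All servers
      meet at \<open>x\<close>; the two groups together travel
      \<open>g * (x - a) + g * (b - x)\<close>.\<close>
    have "serves (L \<union> U) (spread L x x) [x] (spread L x x) (0 + 0)"
      using j by (intro serves.request serves.move) (auto simp: spread_def)
    from serves_excursion[OF this, of "spread L a b" "g * (b - a)"]
    have *: "serves (L \<union> U) (spread L a b) [x] (spread L a b) (0 + 0 + 2 * (g * (b - a)))"
      using single by (simp add: moving_cost_spread[OF fin] g algebra_simps)
    have e: "extra a b (length [x])
        = 2 * real g * real t * (b - a) + 2 * real g * real t * W * (2 / m - 1)"
      using False by (simp add: extra_def)
    have "2 * (real g * (b - a)) \<le> 2 * real g * real t * (b - a)"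
      using t g single by (simp add: mult_le_cancel_left mult_le_cancel_right1)
    moreover have "0 \<le> 2 * real g * real t * W * (2 / m - 1)"
      using False m single by (intro mult_nonneg_nonneg) (auto simp: field_simps)
    moreover have "0 \<le> F * (b - a)" using F single by simp
    ultimately have "0 + 0 + 2 * (real g * (b - a)) \<le> F * (b - a) + extra a b (length [x])"
      unfolding e by linarith
    with * show ?thesis by (rule serves_mono)
  qed
next
  case (blocks n lo hi xs a b)
  let ?X = "concat (map xs [0..<n])" and ?K = "L \<union> U"
  define w where "w i = hi i - lo i" for i
  define w0 where "w0 = b - a"
  define len where "len i = real (length (xs i))" for i
  define G where "G = 2 * real g * real t"
  have G: "0 \<le> G" by (simp add: G_def)
  have wi: "lo i \<le> hi i" if "i < n" for i
    using separable_within_le blocks.hyps(3) that by blast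
  have ab: "a \<le> b"
    using wi[OF blocks.hyps(1)] blocks.hyps(4,5)[OF blocks.hyps(1)] by linarith
  have sep: "separable_within t a b ?X"
    using blocks.hyps by (intro separable_within.blocks)
  have w_nonneg: "0 \<le> w i" if "i < n" for i using wi that by (simp add: w_def)
  have sum_w: "(\<Sum>i<n. w i) \<le> w0"
    unfolding w_def w0_def using wi ab blocks.hyps
    by (intro sum_lengths_disjoint_intervals_le) auto
  have sum_len: "real (length ?X) = (\<Sum>i<n. len i)"
    by (simp add: length_concat comp_def sum_list_sum_nth atLeast0LessThan len_def)
  have IH: "serves ?K (spread L (lo i) (hi i)) (xs i) (spread L (lo i) (hi i))
      (F * w i + extra (lo i) (hi i) (length (xs i)))" if "i < n" for i
    unfolding w_def using blocks.IH[OF that] blocks.hyps(4,5)[OF that] blocks.prems by simp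
  \<comment> \<open>Both groups move from the ends of the block to those of the child and back:
    \<open>g * (lo i - a) + g * (b - hi i)\<close> each way.\<close>
  have exc: "serves ?K (spread L a b) (xs i) (spread L a b)
      (F * w i + extra (lo i) (hi i) (length (xs i)) + 2 * (g * (w0 - w i)))" if "i < n" for i
    using blocks.hyps(4,5)[OF that]
    by (intro serves_excursion[OF IH[OF that]])
      (simp add: moving_cost_spread[OF fin] g w_def w0_def algebra_simps)
  define B where "B = {i. i < n \<and> m \<le> len i}"
  have finB: "finite B" by (simp add: B_def)
  have extraB: "extra (lo i) (hi i) (length (xs i))
      = (if i \<in> B then G * w i + G * W * (2 * len i / m - 1) else 0)" if "i < n" for i
    using that by (auto simp: extra_def B_def len_def w_def G_def)
  \<comment> \<open>\<open>M\<close> is a uniform allowance for travelling per child; each case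
    below chooses its own.\<close>
  have total: "serves ?K (spread L a b) ?X (spread L a b)
      (F * w0 + n * M + (\<Sum>i\<in>B. G * w i + G * W * (2 * len i / m - 1)))"
    if "\<And>i. i < n \<Longrightarrow> serves ?K (spread L a b) (xs i) (spread L a b)
      (F * w i + M + extra (lo i) (hi i) (length (xs i)))" for M :: real
  proof -
    have "(\<Sum>i<n. F * w i + M + extra (lo i) (hi i) (length (xs i)))
        = F * (\<Sum>i<n. w i) + n * M
          + (\<Sum>i<n. if i \<in> B then G * w i + G * W * (2 * len i / m - 1) else 0)"
      by (simp add: sum.distrib sum_distrib_left extraB)
    also have "(\<Sum>i<n. if i \<in> B then G * w i + G * W * (2 * len i / m - 1) else 0)
        = (\<Sum>i\<in>{..<n} \<inter> B. G * w i + G * W * (2 * len i / m - 1))"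
      by (simp add: sum.If_cases)
    also have "{..<n} \<inter> B = B" by (auto simp: B_def)
    also have "F * (\<Sum>i<n. w i) \<le> F * w0" using sum_w F by (rule mult_left_mono)
    finally show ?thesis
      by (intro serves_mono[OF serves_concat[OF that]]) auto
  qed
  have n: "n * M \<le> t * M" if "0 \<le> M" for M :: real
    using that blocks.hyps(2) by (intro mult_right_mono) auto
  have W: "0 \<le> W" "w0 \<le> W" "0 \<le> w0" using ab blocks.prems by (auto simp: w0_def)
  show ?case
  proof (cases "real (length ?X) < m")
    case True
    have "serves L (spread L a b) ?X (spread L a b) (F * (b - a))"
      using sep True ab by (intro small) (auto simp: spread_def)
    then show ?thesis
      using True fin by (auto simp: extra_def intro: serves_superset)
  next
    case False
    then have ex: "extra a b (length ?X) = G * w0 + G * W * (2 * (\<Sum>i<n. len i) / m - 1)"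
      by (simp add: extra_def G_def w0_def sum_len)
    have lenm: "1 \<le> (\<Sum>i<n. len i) / m" using False m by (simp add: sum_len)
    have sum_len_B: "(\<Sum>i\<in>B. len i) \<le> (\<Sum>i<n. len i)"
      by (intro sum_mono2) (auto simp: B_def len_def)
    have sum_w_B: "(\<Sum>i\<in>B. w i) \<le> w0"
      using w_nonneg by (intro order_trans[OF sum_mono2 sum_w]) (auto simp: B_def)
    show ?thesis
    proof (cases "card B = 1")
      case True
      then obtain u where B: "B = {u}" by (auto simp: card_1_singleton_iff)
      then have u: "u < n" by (auto simp: B_def)
      \<comment> \<open>This is the round trip to the large child \<open>u\<close>; it will also pay
        for the trip to any small sibling.\<close>
      define M where "M = 2 * (g * (w0 - w u))"
      have M: "0 \<le> M" using sum_w_B B by (simp add: M_def)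
      have "serves ?K (spread L a b) (xs i) (spread L a b)
        (F * w i + M + extra (lo i) (hi i) (length (xs i)))" if i: "i < n" for i
      proof (cases "i = u")
        case True
        then show ?thesis using exc[OF u] by (simp add: M_def algebra_simps)
      next
        case iu: False
        then have "i \<notin> B" by (simp add: B)
        then have sm: "real (length (xs i)) < m" and ex0: "extra (lo i) (hi i) (length (xs i)) = 0"
          using i by (auto simp: B_def len_def extra_def)
        note i_bd = blocks.hyps(4,5)[OF i] and u_bd = blocks.hyps(4,5)[OF u]
        consider "hi i \<le> lo u" | "hi u \<le> lo i"
          using blocks.hyps(6)[OF i u iu] by blast
        then show ?thesis
        proof cases
          case 1
          \<comment> \<open>The upper group rests at \<open>b\<close>. The lower group climbs only
            to \<open>lo i\<close>, hence at most \<open>lo u - a\<close>, which is at most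
            \<open>w0 - w u\<close>.\<close>
          have "serves L (spread L (lo i) b) (xs i) (spread L (lo i) b) (F * w i)"
            unfolding w_def using blocks.hyps(3)[OF i] sm wi[OF i]
            by (intro small) (auto simp: spread_def)
          then have "serves ?K (spread L (lo i) b) (xs i) (spread L (lo i) b) (F * w i)"
            using fin by (auto intro: serves_superset)
          moreover have "moving_cost ?K (spread L a b) (spread L (lo i) b) \<le> M / 2"
            using i_bd u_bd 1 wi[OF i]
            by (auto simp: moving_cost_spread[OF fin] g M_def w_def w0_def intro!: mult_left_mono)
          ultimately have "serves ?K (spread L a b) (xs i) (spread L a b) (F * w i + 2 * (M / 2))"
            by (rule serves_excursion)
          then show ?thesis using ex0 by simp
        next
          case 2
          have "serves U (spread L a (hi i)) (xs i) (spread L a (hi i)) (F * w i)"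
            unfolding w_def using blocks.hyps(3)[OF i] sm wi[OF i] fin(3)
            by (intro small) (auto simp: spread_def)
          then have "serves ?K (spread L a (hi i)) (xs i) (spread L a (hi i)) (F * w i)"
            using fin by (auto intro: serves_superset)
          moreover have "moving_cost ?K (spread L a b) (spread L a (hi i)) \<le> M / 2"
            using i_bd u_bd 2 wi[OF i]
            by (auto simp: moving_cost_spread[OF fin] g M_def w_def w0_def intro!: mult_left_mono)
          ultimately have "serves ?K (spread L a b) (xs i) (spread L a b) (F * w i + 2 * (M / 2))"
            by (rule serves_excursion)
          then show ?thesis using ex0 by simp
        qed
      qed
      from total[OF this] have "serves ?K (spread L a b) ?X (spread L a b)
          (F * w0 + n * M + (G * w u + G * W * (2 * len u / m - 1)))"
        by (simp add: B)
      \<comment> \<open>The telescoping: together with the width term \<open>G * w u\<close> of the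
        child this gives the width term \<open>G * w0\<close> of the block.\<close>
      moreover have "n * M \<le> G * w0 - G * w u"
        using n[OF M] by (simp add: M_def G_def algebra_simps)
      moreover have "G * W * (2 * len u / m - 1) \<le> G * W * (2 * (\<Sum>i<n. len i) / m - 1)"
        using sum_len_B B m G W by (intro mult_left_mono) (auto simp: divide_right_mono)
      ultimately show ?thesis
        unfolding ex w0_def[symmetric] by (elim serves_mono) linarith
    next
      case False
      define M where "M = 2 * (g * w0)"
      have M: "0 \<le> M" using W by (simp add: M_def)
      have "serves ?K (spread L a b) (xs i) (spread L a b)
        (F * w i + M + extra (lo i) (hi i) (length (xs i)))" if i: "i < n" for i
        using w_nonneg[OF i] by (intro serves_mono[OF exc[OF i]]) (simp add: M_def mult_left_mono)
      from total[OF this] have tot: "serves ?K (spread L a b) ?X (spread L a b)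
          (F * w0 + n * M + (\<Sum>i\<in>B. G * w i + G * W * (2 * len i / m - 1)))" .
      have nM: "n * M \<le> G * w0" using n[OF M] by (simp add: M_def G_def algebra_simps)
      have "G * w0 + (\<Sum>i\<in>B. G * w i + G * W * (2 * len i / m - 1))
          \<le> G * w0 + G * W * (2 * (\<Sum>i<n. len i) / m - 1)"
      proof (cases "B = {}")
        case True
        \<comment> \<open>Without large children the travelling is paid by \<open>G * w0\<close>
          alone; the other term is nonnegative since the block itself is large.\<close>
        then show ?thesis using lenm G W by simp
      next
        case ne: False
        with False finB have "2 \<le> card B"
          by (metis One_nat_def Suc_leI card_gt_0_iff le_neq_implies_less numeral_2_eq_2)
        then have c: "2 \<le> real (card B)" by simp
        have "(\<Sum>i\<in>B. G * w i + G * W * (2 * len i / m - 1))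
            = G * (\<Sum>i\<in>B. w i) + G * W * (2 * (\<Sum>i\<in>B. len i) / m - card B)"
          by (simp add: sum.distrib sum_distrib_left[symmetric] sum_subtractf
              sum_divide_distrib[symmetric])
        \<comment> \<open>Two or more large children contribute at least two of the
          \<open>- 1\<close>. One remains in \<open>extra\<close> for the block, the other pays for
          the width terms of the children, at most \<open>G * W\<close> in total.\<close>
        also have "\<dots> \<le> G * W + G * W * (2 * (\<Sum>i<n. len i) / m - 2)"
          using sum_w_B W G c sum_len_B m
          by (intro add_mono mult_left_mono diff_mono divide_right_mono) auto
        finally show ?thesis by (simp add: algebra_simps)
      qed
      with nM show ?thesis
        unfolding ex w0_def[symmetric] by (intro serves_mono[OF tot]) linarith
    qed
  qed
qed

section \<open>Induction on the number of doublings\<close>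

lemma serves_power_of_two:
  assumes t: "2 \<le> t"
    and "finite J" "card J = 2 ^ d" "separable_within t a b xs" "\<And>j. j \<in> J \<Longrightarrow> p j \<in> {a..b}"
  shows "serves J p xs p (6 * 2 ^ d * real t * real (length xs) powr (1 / (real d + 1)) * (b - a))"
  using assms(2-)
\<comment> \<open>Either group has to serve any small block from any starting positions in its
  interval, so all of these are generalised.\<close>
proof (induction d arbitrary: J a b xs p)
  case 0
  then obtain j where j: "J = {j}" by (auto simp: card_1_singleton_iff)
  have ab: "a \<le> b" using separable_within_le[OF "0"(3)] .
  have len: "1 \<le> length xs" using separable_within_nonempty[OF "0"(3)] by (simp add: Suc_leI)
  have "serves J p xs p (real (length xs + 1) * (b - a))"
    unfolding j using separable_within_subset[OF "0"(3)] 0(4)[of j] j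
    by (intro serves_single_server) auto
  moreover have "real (length xs + 1) \<le> 6 * real t * real (length xs)"
  proof -
    have "real (length xs + 1) \<le> 6 * 1 * real (length xs)" using len by simp
    also have "\<dots> \<le> 6 * real t * real (length xs)"
      using t by (intro mult_right_mono mult_left_mono) auto
    finally show ?thesis .
  qed
  then have "real (length xs + 1) * (b - a) \<le> 6 * real t * real (length xs) * (b - a)"
    using ab by (intro mult_right_mono) auto
  ultimately have "serves J p xs p (6 * real t * real (length xs) * (b - a))" by (rule serves_mono)
  then show ?case using len by simp
next
  case (Suc d)
  have "2 ^ d \<le> card J" using Suc.prems(2) by simp
  then obtain L where L: "L \<subseteq> J" "card L = 2 ^ d"
    using obtain_subset_with_card_n by metis
  define U where "U = J - L"
  have finL: "finite L" using finite_subset[OF L(1) Suc.prems(1)] .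
  have U: "card U = 2 ^ d"
    unfolding U_def using card_Diff_subset[OF finL L(1)] L(2) Suc.prems(2) by simp
  have J: "J = L \<union> U" using L by (auto simp: U_def)
  define n where "n = real (length xs)"
  \<comment> \<open>This threshold balances the two costs: the induction bound for length
    \<open>m\<close> has the factor \<open>m powr (1 / (d + 1)) = N\<close>, and the number of large
    blocks that count is of order \<open>n / m = N\<close>.\<close>
  define m where "m = n powr ((real d + 1) / (real d + 2))"
  define N where "N = n powr (1 / (real d + 2))"
  define F where "F = 6 * 2 ^ d * real t * N"
  define w where "w = b - a"
  have n: "1 \<le> n"
    using separable_within_nonempty[OF Suc.prems(3)] by (simp add: n_def Suc_leI)
  have ab: "a \<le> b" using separable_within_le[OF Suc.prems(3)] .
  have N: "1 \<le> N" using n by (simp add: N_def ge_one_powr_ge_zero)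
  have mN: "m powr (1 / (real d + 1)) = N"
    by (simp add: m_def N_def powr_powr)
  have "m * N = n powr ((real d + 1) / (real d + 2) + 1 / (real d + 2))"
    by (simp add: m_def N_def powr_add)
  also have "(real d + 1) / (real d + 2) + 1 / (real d + 2) = 1"
    by (simp add: add_divide_distrib[symmetric])
  finally have mN': "n = m * N" using n by (simp add: powr_one)
  have m: "0 < m" using n by (simp add: m_def)
  then have "m \<le> n" using mN' N by simp
  have F: "0 \<le> F" using N by (simp add: F_def)
  have "serves (L \<union> U) (spread L a b) xs (spread L a b) (F * (b - a) +
    (if real (length xs) < m then 0 else 2 * real (2 ^ d) * real t * (b - a)
      + 2 * real (2 ^ d) * real t * (b - a) * (2 * real (length xs) / m - 1)))"
  proof (rule serves_two_groups[OF finL _ _ L(2) U _ _ m F _ Suc.prems(3)])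
    fix I a b xs p
    assume I: "I \<in> {L, U}" and s: "separable_within t a b xs" and l: "real (length xs) < m"
      and p: "\<And>j. j \<in> I \<Longrightarrow> p j \<in> {a..b}"
    have "finite I" "card I = 2 ^ d"
      using I finL L(2) U Suc.prems(1) by (auto simp: U_def)
    from Suc.IH[OF this s p] show "serves I p xs p (F * (b - a))"
    proof (rule serves_mono)
      have "length xs powr (1 / (real d + 1)) \<le> N"
        unfolding mN[symmetric] using l by (intro powr_mono2) auto
      then show "6 * 2 ^ d * real t * real (length xs) powr (1 / (real d + 1)) * (b - a) \<le> F * (b - a)"
        unfolding F_def using separable_within_le[OF s]
        by (intro mult_right_mono mult_left_mono) auto
    qed
  qed (use t Suc.prems(1) in \<open>auto simp: U_def\<close>)
  \<comment> \<open>The whole sequence is large. As \<open>W\<close> is \<open>b - a\<close>, the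
    \<open>- 1\<close> cancels the width term and \<open>2 * n / m = 2 * N\<close> is left as
    factor.\<close>
  moreover have "(if real (length xs) < m then 0 else 2 * real (2 ^ d) * real t * (b - a)
      + 2 * real (2 ^ d) * real t * (b - a) * (2 * real (length xs) / m - 1))
    = 4 * 2 ^ d * real t * N * w"
    using \<open>m \<le> n\<close> m mN' by (simp add: n_def[symmetric] w_def algebra_simps)
  ultimately have "serves J (spread L a b) xs (spread L a b) (F * w + 4 * 2 ^ d * real t * N * w)"
    by (simp add: w_def J[symmetric])
  moreover have "moving_cost J p (spread L a b) \<le> 2 ^ Suc d * w"
    using moving_cost_le[of J p a b "spread L a b"] Suc.prems(2,4) ab
    by (simp add: w_def spread_def)
  ultimately have "serves J p xs p (F * w + 4 * 2 ^ d * real t * N * w + 2 * (2 ^ Suc d * w))"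
    by (rule serves_excursion)
  moreover have "F * w + 4 * 2 ^ d * real t * N * w + 2 * (2 ^ Suc d * w)
    \<le> 6 * 2 ^ Suc d * real t * N * w"
  proof -
    \<comment> \<open>Where 6 comes from: in units of \<open>2 ^ d * t * N * w\<close>, the small
      blocks cost 6, the large ones 4, and the trip from \<open>p\<close> and back at most 2 because
      \<open>t * N\<close> is at least 2. The sum 12 is twice 6.\<close>
    have "2 * 1 \<le> t * N" using t N by (intro mult_mono) auto
    then have "2 * 2 ^ d * w * 2 \<le> 2 * 2 ^ d * w * (t * N)"
      using ab by (intro mult_left_mono) (auto simp: w_def)
    then show ?thesis by (simp add: F_def algebra_simps)
  qed
  ultimately have "serves J p xs p (6 * 2 ^ Suc d * real t * N * w)"
    by (rule serves_mono)
  moreover have "1 / (real (Suc d) + 1) = 1 / (real d + 2)" by simp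
  ultimately show ?case
    unfolding N_def n_def w_def by metis
qed

section \<open>Arbitrary numbers of servers\<close>

theorem theorem3p10:
  shows "\<exists>C :: real. \<forall>t k n :: nat. \<forall>X :: real list.
    t \<ge> 2 \<longrightarrow> k \<ge> 1 \<longrightarrow> length X = n \<longrightarrow> set X \<subseteq> {0..1} \<longrightarrow> separable_seq t X \<longrightarrow>
    OPT k X \<le> C * real k * real t * real n powr (1 / (of_int \<lfloor>log 2 (real k)\<rfloor> + 1))"
proof (intro exI[of _ 6] allI impI)
  fix t k n :: nat and X :: "real list"
  assume t: "t \<ge> 2" and k: "k \<ge> 1" and n: "length X = n" and X: "set X \<subseteq> {0..1}"
    and sep: "separable_seq t X"
  define d where "d = nat \<lfloor>log 2 (real k)\<rfloor>"
  have d: "of_int \<lfloor>log 2 (real k)\<rfloor> = real d" using k by (simp add: d_def)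
  have "2 powr real d \<le> 2 powr log 2 (real k)"
    unfolding d[symmetric] by (intro powr_mono) auto
  then have dk: "2 ^ d \<le> real k" using k by (simp add: powr_realpow)
  then have dk': "2 ^ d \<le> k" by (simp add: numeral_power_le_of_nat_cancel_iff)
  \<comment> \<open>Only \<open>2 ^ d\<close> of the \<open>k\<close> servers work; the others stay
    at 0 throughout.\<close>
  have "serves {1..2 ^ d :: nat} (\<lambda>_. 0) X (\<lambda>_. 0)
      (6 * 2 ^ d * real t * real (length X) powr (1 / (real d + 1)) * (1 - 0))"
    by (rule serves_power_of_two[OF t _ _ separable_seq_within[OF sep X]]) auto
  then have "serves {1..k} (\<lambda>_. 0) X (\<lambda>_. 0) (6 * 2 ^ d * real t * real n powr (1 / (real d + 1)))"
    using dk' by (auto simp: n elim!: serves_superset)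
  from OPT_le_serves[OF k X this]
  have "OPT k X \<le> 6 * 2 ^ d * real t * real n powr (1 / (real d + 1))" .
  also have "\<dots> \<le> 6 * real k * real t * real n powr (1 / (real d + 1))"
    using dk by (intro mult_right_mono mult_left_mono) auto
  finally show "OPT k X \<le> 6 * real k * real t
      * real n powr (1 / (of_int \<lfloor>log 2 (real k)\<rfloor> + 1))"
    by (simp add: d)
qed

end
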